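(* Let $\mu,\nu$ be probability measures supported on countable subsets $X$ and $Y$ of $[0,\infty)$ respectively, with $\int x\,\mu(dx)=\int y\,\nu(dy)=1$ and $\mu\preccurlyeq\nu$ in the convex order. Let $S$ be the support of the left curtain $\pi_{\mathrm{lc}}$ (resp. right curtain $\pi_{\mathrm{rc}}$) in $\mathcal M(\mu,\nu)$. Assume that there exists a strictly decreasing (resp. strictly increasing) numbering of $S_X$, i.e. $S_X=(x_n)_{n\ge1}$ with $x_1>x_2>\cdots$ (resp. $x_1<x_2<\cdots$). Then $S$ has the 2-link property. In particular the WEP holds for $S$ and, if moreover there is a finite set $\{z_1,\dots,z_m\}\subset S_X$ such that $S_Y=\bigcup_{i=1}^mY(z_i)$, then $\pi_{\mathrm{lc}}$ (resp. $\pi_{\mathrm{rc}}$) is extremal in $\mathcal M(\mu,\nu)$.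
   Context: $\mu\preccurlyeq\nu$ in the convex order means $\int c\,d\mu\le\int c\,d\nu$ for all convex $c:[0,\infty)\to\mathbb R$. $\mathcal M(\mu,\nu)$ is the set of probability measures $Q$ on $[0,\infty)^2$ with marginals $\mu,\nu$ satisfying the martingale property: if $Q(dx,dy)=q(x,dy)\mu(dx)$ then $\int y\,q(x,dy)=x$ for $\mu$-a.e. $x$. $Q\in\mathcal M(\mu,\nu)$ is extremal if $Q=\alpha Q_1+(1-\alpha)Q_2$ with $\alpha\in(0,1)$, $Q_1,Q_2\in\mathcal M(\mu,\nu)$ implies $Q=Q_1=Q_2$. Curtains: $\pi\in\mathcal M(\mu,\nu)$ is left-monotone if there is a Borel set $\Gamma\subset\mathbb R\times\mathbb R$ with $\pi(\Gamma)=1$ such that whenever $(x,y^-),(x,y^+),(x',y')\in\Gamma$ one cannot have $x<x'$ and $y^-<y'<y^+$. It is known (Beiglböck–Juillet) that there is a unique left-monotone element of $\mathcal M(\mu,\nu)$, called the left curtain $\pi_{\mathrm{lc}}$. The right curtain $\pi_{\mathrm{rc}}$ is defined in the same way with "$x<x'$" replaced by "$x>x'$" in the forbidden pattern. Supports: the support of $Q$ is $S=\{(x,y)\in X\times Y:Q(\{(x,y)\})>0\}$; $S_X,S_Y$ are its projections and $Y(x)=\{y\in Y:(x,y)\in S\}$. $S$ has the 2-link property if there is a numbering (finite or infinite sequence without repetition) $S_X=(x_n)_{n\ge1}$ such that $\left|Y(x_n)\cap\bigcup_{i=1}^{n-1}Y(x_i)\right|\le2$ for all $n\ge1$. The WEP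 holds for $S$ if for every $f:S\to\mathbb R$ there exist $\varphi,h:S_X\to\mathbb R$ and $\psi:S_Y\to\mathbb R$ with $f(x,y)=\varphi(x)+h(x)(y-x)-\psi(y)$ for all $(x,y)\in S$. *)

theory Defs
  imports "HOL-Probability.Probability"
begin

text \<open>
  Probability measures on \<open>[0, \<infinity>)\<close> and \<open>[0, \<infinity>)\<^sup>2\<close> are Borel probability measures on the real
  line and on the plane that give mass one to \<open>[0, \<infinity>)\<close> and \<open>[0, \<infinity>)\<^sup>2\<close>, respectively.
\<close>

subsection \<open>Convex order\<close>

text \<open>
  The integral of a convex \<open>c\<close> may be \<open>\<infinity>\<close>, which the Bochner integral would turn into \<open>0\<close>. When
  \<open>M\<close> has a finite first moment, the negative part of \<open>c\<close> is integrable because \<open>c\<close> dominates an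
  affine function, so the difference below is never \<open>\<infinity> - \<infinity>\<close>.
\<close>

definition halfline_integral :: "real measure \<Rightarrow> (real \<Rightarrow> real) \<Rightarrow> ereal" where
  "halfline_integral M c =
     enn2ereal (\<integral>\<^sup>+x\<in>{0..}. ennreal (c x) \<partial>M) - enn2ereal (\<integral>\<^sup>+x\<in>{0..}. ennreal (- c x) \<partial>M)"

definition convex_order :: "real measure \<Rightarrow> real measure \<Rightarrow> bool" where
  "convex_order \<mu> \<nu> \<longleftrightarrow>
     (\<forall>c. convex_on {0..} c \<longrightarrow> halfline_integral \<mu> c \<le> halfline_integral \<nu> c)"

subsection \<open>Martingale couplings\<close>

definition disintegration ::
  "(real \<times> real) measure \<Rightarrow> real measure \<Rightarrow> (real \<Rightarrow> real measure) \<Rightarrow> bool" where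
  "disintegration Q \<mu> q \<longleftrightarrow>
     q \<in> borel \<rightarrow>\<^sub>M prob_algebra borel \<and>
     (\<forall>A\<in>sets borel. emeasure Q A = (\<integral>\<^sup>+x. emeasure (q x) {y. (x, y) \<in> A} \<partial>\<mu>))"

text \<open>
  A disintegration exists and is unique up to \<open>\<mu>\<close>-null sets, so the martingale property may be
  required of one disintegration or, equivalently, of all of them.
\<close>

definition martingale_couplings ::
  "real measure \<Rightarrow> real measure \<Rightarrow> (real \<times> real) measure set" where
  "martingale_couplings \<mu> \<nu> =
     {Q. prob_space Q \<and> sets Q = sets borel \<and> emeasure Q ({0..} \<times> {0..}) = 1 \<and>
         distr Q borel fst = \<mu> \<and> distr Q borel snd = \<nu> \<and>
         (\<exists>q. disintegration Q \<mu> q \<and> (AE x in \<mu>. has_bochner_integral (q x) (\<lambda>y. y) x))}"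

definition extremal_coupling ::
  "real measure \<Rightarrow> real measure \<Rightarrow> (real \<times> real) measure \<Rightarrow> bool" where
  "extremal_coupling \<mu> \<nu> Q \<longleftrightarrow>
     Q \<in> martingale_couplings \<mu> \<nu> \<and>
     (\<forall>\<alpha> Q1 Q2. 0 < \<alpha> \<and> \<alpha> < 1 \<and>
        Q1 \<in> martingale_couplings \<mu> \<nu> \<and> Q2 \<in> martingale_couplings \<mu> \<nu> \<and>
        (\<forall>A\<in>sets borel. measure Q A = \<alpha> * measure Q1 A + (1 - \<alpha>) * measure Q2 A)
        \<longrightarrow> Q = Q1 \<and> Q = Q2)"

subsection \<open>Curtains\<close>

definition left_monotone :: "(real \<times> real) measure \<Rightarrow> bool" where
  "left_monotone \<pi> \<longleftrightarrow>
     (\<exists>\<Gamma>\<in>sets borel. emeasure \<pi> \<Gamma> = 1 \<and>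
        (\<forall>x y1 y2 x' y'. (x, y1) \<in> \<Gamma> \<and> (x, y2) \<in> \<Gamma> \<and> (x', y') \<in> \<Gamma>
           \<longrightarrow> \<not> (x < x' \<and> y1 < y' \<and> y' < y2)))"

definition right_monotone :: "(real \<times> real) measure \<Rightarrow> bool" where
  "right_monotone \<pi> \<longleftrightarrow>
     (\<exists>\<Gamma>\<in>sets borel. emeasure \<pi> \<Gamma> = 1 \<and>
        (\<forall>x y1 y2 x' y'. (x, y1) \<in> \<Gamma> \<and> (x, y2) \<in> \<Gamma> \<and> (x', y') \<in> \<Gamma>
           \<longrightarrow> \<not> (x > x' \<and> y1 < y' \<and> y' < y2)))"

text \<open>
  By a theorem of Beiglboeck and Juillet there is exactly one left-monotone and exactly one
  right-monotone martingale coupling when \<open>\<mu>\<close> is below \<open>\<nu>\<close> in the convex order. The curtains are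
  therefore given by their defining predicates, without a description operator.
\<close>

definition is_left_curtain ::
  "real measure \<Rightarrow> real measure \<Rightarrow> (real \<times> real) measure \<Rightarrow> bool" where
  "is_left_curtain \<mu> \<nu> \<pi> \<longleftrightarrow> \<pi> \<in> martingale_couplings \<mu> \<nu> \<and> left_monotone \<pi>"

definition is_right_curtain ::
  "real measure \<Rightarrow> real measure \<Rightarrow> (real \<times> real) measure \<Rightarrow> bool" where
  "is_right_curtain \<mu> \<nu> \<pi> \<longleftrightarrow> \<pi> \<in> martingale_couplings \<mu> \<nu> \<and> right_monotone \<pi>"

subsection \<open>Supports, the 2-link property and the WEP\<close>

definition atoms_on ::
  "real set \<Rightarrow> real set \<Rightarrow> (real \<times> real) measure \<Rightarrow> (real \<times> real) set" where
  "atoms_on X Y Q = {(x, y). x \<in> X \<and> y \<in> Y \<and> measure Q {(x, y)} > 0}"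

definition fibre :: "(real \<times> real) set \<Rightarrow> real \<Rightarrow> real set" where
  "fibre S x = {y. (x, y) \<in> S}"

text \<open>Indices start at 1; \<open>N = \<infinity>\<close> gives infinite numberings.\<close>

definition index_set :: "enat \<Rightarrow> nat set" where
  "index_set N = {n. 1 \<le> n \<and> enat n \<le> N}"

definition is_numbering :: "real set \<Rightarrow> enat \<Rightarrow> (nat \<Rightarrow> real) \<Rightarrow> bool" where
  "is_numbering A N x \<longleftrightarrow> bij_betw x (index_set N) A"

definition two_link_property :: "(real \<times> real) set \<Rightarrow> bool" where
  "two_link_property S \<longleftrightarrow>
     (\<exists>N x. is_numbering (fst ` S) N x \<and>
        (\<forall>n\<in>index_set N.
           finite (fibre S (x n) \<inter> (\<Union>i\<in>{1..<n}. fibre S (x i))) \<and>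
           card (fibre S (x n) \<inter> (\<Union>i\<in>{1..<n}. fibre S (x i))) \<le> 2))"

text \<open>Values of the functions outside \<open>S\<close> and its projections are irrelevant.\<close>

definition WEP :: "(real \<times> real) set \<Rightarrow> bool" where
  "WEP S \<longleftrightarrow>
     (\<forall>f :: real \<times> real \<Rightarrow> real. \<exists>\<phi> h \<psi> :: real \<Rightarrow> real.
        \<forall>(x, y)\<in>S. f (x, y) = \<phi> x + h x * (y - x) - \<psi> y)"

end

theory Submission
  imports Defs
begin

text \<open>
  By monotonicity of the curtain, a point of \<open>Y(x\<^sub>n)\<close> that already occurs in an earlier fibre is not
  strictly between two points of \<open>Y(x\<^sub>n)\<close>, hence is its minimum or its maximum. This is the 2-link
  property. It gives the WEP because \<open>\<phi>(x\<^sub>n)\<close> and \<open>h(x\<^sub>n)\<close> can be chosen recursively by affine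
  interpolation at the at most two points where \<open>\<psi>\<close> is already determined.

  For extremality, represent the indicator of a point of \<open>S\<close> as \<open>\<phi>(x) + h(x) (y - x) - \<psi>(y)\<close> on \<open>S\<close>.
  On each of the finitely many fibres that cover \<open>S\<^sub>Y\<close> the function \<open>\<psi>\<close> is affine up to a bounded
  term, so it is \<open>\<nu>\<close>-integrable. Then \<open>\<phi>(x) + h(x) (y - x)\<close> is integrable too, and its integral
  against a martingale coupling, computed fibre by fibre, depends only on \<open>\<mu>\<close>. Hence all couplings
  concentrated on \<open>S\<close> have the same mass at the given point.
\<close>

section \<open>Martingale couplings\<close>

lemmas borel_measurable_projections =
  borel_measurable_continuous_onI[OF continuous_on_fst[OF continuous_on_id]]
  borel_measurable_continuous_onI[OF continuous_on_snd[OF continuous_on_id]]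

text \<open>At an atom \<open>x\<close> of \<open>\<mu>\<close> the kernel \<open>q x\<close> has
  mean \<open>x\<close>, so the slope term integrates to zero over the fibre. The value involves
  \<open>\<mu>\<close> but not the choice of \<open>Q\<close>, which is what makes two couplings
  comparable.\<close>

lemma martingale_coupling_fibre_integral:
  fixes a b x :: real
  assumes Q: "Q \<in> martingale_couplings \<mu> \<nu>" and "finite_measure \<mu>" and \<mu>: "sets \<mu> = sets borel"
  shows "has_bochner_integral Q (\<lambda>s. indicator {x} (fst s) * (a + b * (snd s - x)))
           (measure \<mu> {x} * a)"
proof -
  have sQ[measurable_cong]: "sets Q = sets borel"
    using Q by (simp add: martingale_couplings_def)
  note [measurable] = borel_measurable_projections
  have snd: "snd \<in> borel_measurable Q" by measurable
  obtain q where q: "disintegration Q \<mu> q"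
    and mart: "AE x in \<mu>. has_bochner_integral (q x) (\<lambda>y. y) x"
    using Q by (auto simp: martingale_couplings_def)
  have qx: "q x \<in> space (prob_algebra borel)"
    using q by (auto simp: disintegration_def measurable_space)
  then have sq[measurable_cong]: "sets (q x) = sets borel" and pq: "prob_space (q x)"
    by (auto simp: space_prob_algebra)
  define r where "r = measure \<mu> {x}"
  have r0: "r \<ge> 0" by (simp add: r_def)
  \<comment> \<open>The part of \<open>Q\<close> over \<open>x\<close>, pushed to the second
    coordinate, is the kernel \<open>q x\<close> scaled by the mass of \<open>x\<close>. This turns
    a fibre integral against \<open>Q\<close> into an integral against \<open>q x\<close>.\<close>
  have slice: "distr (density Q (\<lambda>s. ennreal (indicator {x} (fst s)))) borel snd
      = density (q x) (\<lambda>_. ennreal r)" (is "?M1 = ?M2")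
  proof (rule measure_eqI)
    show "sets ?M1 = sets ?M2" by (simp add: sq)
    fix A assume "A \<in> sets ?M1"
    then have A[measurable]: "A \<in> sets borel" by simp
    have xA[measurable]: "{x} \<times> A \<in> sets (borel :: (real \<times> real) measure)"
      by (auto simp: borel_prod[symmetric])
    have "emeasure ?M1 A = (\<integral>\<^sup>+s. ennreal (indicator {x} (fst s)) * indicator (snd -` A \<inter> space Q) s \<partial>Q)"
      using measurable_sets[OF snd A] by (simp add: emeasure_distr emeasure_density)
    also have "\<dots> = (\<integral>\<^sup>+s. indicator ({x} \<times> A) s \<partial>Q)"
      by (intro nn_integral_cong) (auto simp: indicator_def)
    also have "\<dots> = emeasure Q ({x} \<times> A)" by simp
    also have "\<dots> = (\<integral>\<^sup>+x'. emeasure (q x') {y. (x', y) \<in> {x} \<times> A} \<partial>\<mu>)"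
      using q xA by (auto simp: disintegration_def)
    also have "\<dots> = (\<integral>\<^sup>+x'. emeasure (q x) A * indicator {x} x' \<partial>\<mu>)"
      by (intro nn_integral_cong) (auto simp: indicator_def)
    also have "\<dots> = emeasure (q x) A * emeasure \<mu> {x}"
      by (intro nn_integral_cmult_indicator) (simp add: \<mu>)
    also have "\<dots> = emeasure ?M2 A"
      by (simp add: emeasure_density_const r_def finite_measure.emeasure_eq_measure[OF assms(2)] mult.commute sq)
    finally show "emeasure ?M1 A = emeasure ?M2 A" .
  qed
  have "has_bochner_integral (q x) (\<lambda>y. r * (a + b * (y - x))) (r * a)"
  proof (cases "r = 0")
    case False
    \<comment> \<open>An almost sure property holds at every atom: otherwise \<open>x\<close> would
      lie in the exceptional null set and \<open>{x}\<close> would be null.\<close>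
    have "has_bochner_integral (q x) (\<lambda>y. y) x"
    proof (rule ccontr)
      assume nint: "\<not> ?thesis"
      obtain E where E: "{z \<in> space \<mu>. \<not> has_bochner_integral (q z) (\<lambda>y. y) z} \<subseteq> E" "E \<in> null_sets \<mu>"
        using mart unfolding eventually_ae_filter by blast
      have "x \<in> E" using E(1) nint sets_eq_imp_space_eq[OF \<mu>] by auto
      then have "{x} \<in> null_sets \<mu>" using null_sets_subset[OF E(2)] \<mu> by auto
      then show False using False by (simp add: r_def measure_def null_sets_def)
    qed
    moreover have "has_bochner_integral (q x) (\<lambda>_. c) c" for c :: real
      using finite_measure.integrable_const[OF prob_space.axioms(1)[OF pq], of c] prob_space.prob_space[OF pq]
      by (simp add: has_bochner_integral_iff)
    ultimately have "has_bochner_integral (q x) (\<lambda>y. r * (a + b * (y - x))) (r * (a + b * (x - x)))"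
      by (intro has_bochner_integral_mult_right has_bochner_integral_add has_bochner_integral_diff)
    then show ?thesis by simp
  \<comment> \<open>If \<open>r = 0\<close>, nothing is known about the mean of \<open>q x\<close>,
    but the integrand and the claimed value are both zero.\<close>
  qed (simp add: has_bochner_integral_zero)
  then have "has_bochner_integral ?M2 (\<lambda>y. a + b * (y - x)) (r * a)"
    using r0 by (intro has_bochner_integral_density) auto
  then have "has_bochner_integral (density Q (\<lambda>s. ennreal (indicator {x} (fst s))))
      (\<lambda>s. a + b * (snd s - x)) (r * a)"
    unfolding slice[symmetric] by (simp add: has_bochner_integral_iff integrable_distr_eq integral_distr)
  then show ?thesis
    unfolding r_def by (simp add: has_bochner_integral_iff integrable_density integral_density)
qed

text \<open>Integrability is assumed for the whole expression, so the integral is not split into a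
  \<open>\<phi>\<close> part and an \<open>h\<close> part. It is truncated to finitely many fibres,
  where each \<open>h\<close> term drops out, and dominated convergence removes the truncation. The
  exhaustion comes from an enumeration of \<open>X\<close>, so measures with the same
  \<open>w\<close> and \<open>X\<close> have the same partial sums.\<close>

lemma integral_affine_by_fibres:
  fixes \<phi> h w :: "real \<Rightarrow> real" and Q :: "(real \<times> real) measure"
  assumes sQ[measurable_cong]: "sets Q = sets borel"
    and fibres: "\<And>x a b. has_bochner_integral Q (\<lambda>s. indicator {x} (fst s) * (a + b * (snd s - x))) (w x * a)"
    and X: "countable X" and XQ: "AE s in Q. fst s \<in> X"
    and int: "integrable Q (\<lambda>s. \<phi> (fst s) + h (fst s) * (snd s - fst s))"
  shows "(\<lambda>n. \<Sum>x\<in>{x\<in>X. to_nat_on X x < n}. w x * \<phi> x)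
           \<longlonglongrightarrow> (\<integral>s. \<phi> (fst s) + h (fst s) * (snd s - fst s) \<partial>Q)"
proof -
  define g where "g s = \<phi> (fst s) + h (fst s) * (snd s - fst s)" for s :: "real \<times> real"
  define E where "E n = {x\<in>X. to_nat_on X x < n}" for n
  note [measurable] = borel_measurable_projections
  have fin: "finite (E n)" for n
    by (rule finite_imageD[of "to_nat_on X"])
      (auto simp: E_def intro: finite_subset[of _ "{..<n}"] inj_on_subset[OF inj_on_to_nat_on[OF X]])
  have E[measurable]: "E n \<in> sets borel" for n
    using fin by (simp add: borel_closed finite_imp_closed)
  have "has_bochner_integral Q
      (\<lambda>s. \<Sum>x\<in>E n. indicator {x} (fst s) * (\<phi> x + h x * (snd s - x))) (\<Sum>x\<in>E n. w x * \<phi> x)" for n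
    by (intro has_bochner_integral_sum fibres)
  moreover have "(\<Sum>x\<in>E n. indicator {x} (fst s) * (\<phi> x + h x * (snd s - x)))
      = indicator (E n) (fst s) * g s" for n s
  proof -
    have "(\<Sum>x\<in>E n. indicator {x} (fst s) * (\<phi> x + h x * (snd s - x)))
        = (\<Sum>x\<in>E n. if x = fst s then g s else 0)"
      by (intro sum.cong) (auto simp: g_def indicator_def)
    then show ?thesis using fin by (simp add: sum.delta' indicator_def)
  qed
  ultimately have trunc: "(\<integral>s. indicator (E n) (fst s) * g s \<partial>Q) = (\<Sum>x\<in>E n. w x * \<phi> x)" for n
    by (simp add: has_bochner_integral_iff)
  have int': "integrable Q g" using int by (simp add: g_def[abs_def])
  then have [measurable]: "g \<in> borel_measurable Q" by simp
  have "(\<lambda>n. \<integral>s. indicator (E n) (fst s) * g s \<partial>Q) \<longlonglongrightarrow> (\<integral>s. g s \<partial>Q)"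
  proof (rule integral_dominated_convergence[where w = "\<lambda>s. norm (g s)"])
    show "AE s in Q. (\<lambda>n. indicator (E n) (fst s) * g s) \<longlonglongrightarrow> g s"
      using XQ
    proof eventually_elim
      case (elim s)
      \<comment> \<open>Each first coordinate in \<open>X\<close> enters \<open>E n\<close> once
        \<open>n\<close> exceeds its code, so the truncations are eventually constant.\<close>
      have "\<forall>\<^sub>F n in sequentially. indicator (E n) (fst s) * g s = g s"
        using eventually_gt_at_top[of "to_nat_on X (fst s)"]
        by eventually_elim (simp add: E_def elim)
      then show ?case by (rule tendsto_eventually)
    qed
    show "AE s in Q. norm (indicator (E n) (fst s) * g s) \<le> norm (g s)" for n
      by (auto simp: indicator_def)
  qed (use int' in auto)
  then show ?thesis unfolding trunc by (simp add: g_def E_def)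
qed

section \<open>Measures carried by countable sets\<close>

lemma atom_in_full_set:
  assumes "prob_space M" and "A \<in> sets M" and "emeasure M A = 1" and "measure M {s} > 0"
  shows "s \<in> A"
proof (rule ccontr)
  note M = \<open>prob_space M\<close>
  assume "s \<notin> A"
  have s: "{s} \<in> sets M" using assms(4) measure_notin_sets by fastforce
  have "AE x in M. x \<in> A"
    using assms(2,3) by (simp add: prob_space.AE_in_set_eq_1[OF M] measure_def)
  then have "AE x in M. x \<notin> {s}" using \<open>s \<notin> A\<close> by (auto elim: eventually_mono)
  then have "measure M {s} = 0" using s by (simp add: prob_space.prob_eq_0[OF M])
  then show False using assms(4) by simp
qed

text \<open>The marginals confine \<open>Q\<close> to the countable set \<open>X \<times> Y\<close>,
  and the points of zero mass in it form a countable union of null sets.\<close>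

lemma AE_in_atoms_on:
  assumes Q: "Q \<in> martingale_couplings \<mu> \<nu>"
    and X: "countable X" "AE x in \<mu>. x \<in> X" and Y: "countable Y" "AE y in \<nu>. y \<in> Y"
  shows "AE s in Q. s \<in> atoms_on X Y Q"
proof -
  have sQ[measurable_cong]: "sets Q = sets borel" and "prob_space Q"
    and d: "distr Q borel fst = \<mu>" "distr Q borel snd = \<nu>"
    using Q by (auto simp: martingale_couplings_def)
  note [measurable] = borel_measurable_projections
  have 1: "AE s in Q. fst s \<in> X"
    using X(2) unfolding d(1)[symmetric] by (rule AE_distrD[rotated]) measurable
  have 2: "AE s in Q. snd s \<in> Y"
    using Y(2) unfolding d(2)[symmetric] by (rule AE_distrD[rotated]) measurable
  define E where "E = {s \<in> X \<times> Y. measure Q {s} = 0}"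
  have "countable E" unfolding E_def using X(1) Y(1) by (intro countable_Collect) auto
  then have "(\<Union>s\<in>E. {s}) \<in> null_sets Q"
    by (intro null_sets_UN') (auto simp: null_sets_def sQ E_def
        finite_measure.emeasure_eq_measure[OF prob_space.axioms(1)[OF \<open>prob_space Q\<close>]])
  then have "AE s in Q. s \<notin> E" by (intro AE_not_in) simp
  with 1 2 show ?thesis
  proof eventually_elim
    case (elim s)
    then show ?case
      by (cases s) (auto simp: atoms_on_def E_def zero_less_measure_iff)
  qed
qed

text \<open>On a countable carrier every measurable set has the sum of its point masses as measure,
  so agreement at points suffices.\<close>

lemma measure_eq_countable_AE:
  assumes "sets M = sets N" and "countable A"
    and "AE x in M. x \<in> A" and "AE x in N. x \<in> A"
    and sing: "\<And>x. x \<in> A \<Longrightarrow> {x} \<in> sets M"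
    and eq: "\<And>x. x \<in> A \<Longrightarrow> emeasure M {x} = emeasure N {x}"
  shows "M = N"
proof (rule measure_eqI[OF assms(1)])
  fix B assume B: "B \<in> sets M"
  have A: "A \<in> sets M" using sets.countable[OF sing \<open>countable A\<close>] by blast
  have atomic: "emeasure L B = (\<integral>\<^sup>+x. emeasure L {x} \<partial>count_space (B \<inter> A))"
    if L: "sets L = sets M" "AE x in L. x \<in> A" for L
  proof -
    have "emeasure L B = emeasure L (B \<inter> A)"
      using L A B by (intro emeasure_eq_AE) (auto elim: eventually_mono)
    also have "\<dots> = (\<integral>\<^sup>+x. emeasure L {x} \<partial>count_space (B \<inter> A))"
      using \<open>countable A\<close> sing L(1) by (intro emeasure_countable_singleton) auto
    finally show ?thesis .
  qed
  show "emeasure M B = emeasure N B"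
    unfolding atomic[OF refl assms(3)] atomic[OF assms(1)[symmetric] assms(4)]
    by (intro nn_integral_cong) (simp add: eq)
qed

section \<open>Extremality\<close>

text \<open>Both measures integrate the fibrewise affine function \<open>g\<close> to their mass at
  \<open>s0\<close> plus the integral of \<open>\<psi>'\<close> against the common marginal
  \<open>\<nu>\<close>. Since \<open>agree\<close> equates the two integrals of \<open>g\<close>,
  the masses coincide. The finite cover \<open>Z\<close> serves to make \<open>\<psi>'\<close>
  integrable.\<close>

lemma WEP_imp_eq_atoms:
  assumes wep: "WEP S" and "countable S"
    and Z: "finite Z" "snd ` S = (\<Union>z\<in>Z. fibre S z)"
    and "finite_measure \<nu>" and \<nu>: "sets \<nu> = sets borel" and mom: "integrable \<nu> (\<lambda>y. y)"
    and Q: "prob_space Q" "sets Q = sets borel" "distr Q borel snd = \<nu>" "AE s in Q. s \<in> S"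
    and R: "prob_space R" "sets R = sets borel" "distr R borel snd = \<nu>" "AE s in R. s \<in> S"
    and agree: "\<And>\<phi> h :: real \<Rightarrow> real. integrable Q (\<lambda>s. \<phi> (fst s) + h (fst s) * (snd s - fst s)) \<Longrightarrow>
      integrable R (\<lambda>s. \<phi> (fst s) + h (fst s) * (snd s - fst s)) \<Longrightarrow>
      (\<integral>s. \<phi> (fst s) + h (fst s) * (snd s - fst s) \<partial>Q) = (\<integral>s. \<phi> (fst s) + h (fst s) * (snd s - fst s) \<partial>R)"
  shows "measure Q {s0} = measure R {s0}"
proof -
  \<comment> \<open>Such a function differs from zero at countably many points and is therefore
    Borel, however irregular \<open>g\<close> is.\<close>
  have countable_support: "(\<lambda>x. if x \<in> A then g x else 0) \<in> borel_measurable borel"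
    if "countable A" for A and g :: "real \<Rightarrow> real"
    by (rule measurable_discrete_difference[of "\<lambda>_. 0" borel borel A]) (use that in auto)
  obtain \<phi> h \<psi> where rep: "\<forall>(x, y)\<in>S. indicator {s0} (x, y) = \<phi> x + h x * (y - x) - \<psi> y"
    using wep unfolding WEP_def by blast
  \<comment> \<open>The WEP yields arbitrary functions. Setting them to 0 off the countable
    projections of \<open>S\<close> makes them measurable and leaves the representation on
    \<open>S\<close> intact.\<close>
  define \<phi>' where "\<phi>' x = (if x \<in> fst ` S then \<phi> x else 0)" for x
  define h' where "h' x = (if x \<in> fst ` S then h x else 0)" for x
  define \<psi>' where "\<psi>' y = (if y \<in> snd ` S then \<psi> y else 0)" for y
  define g where "g s = \<phi>' (fst s) + h' (fst s) * (snd s - fst s)" for s :: "real \<times> real"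
  have [measurable]: "\<phi>' \<in> borel_measurable borel" "h' \<in> borel_measurable borel"
    and \<psi>'[measurable]: "\<psi>' \<in> borel_measurable borel"
    unfolding \<phi>'_def h'_def \<psi>'_def using \<open>countable S\<close>
    by (auto intro!: countable_support)
  have rep': "g s = indicator {s0} s + \<psi>' (snd s)" if "s \<in> S" for s
  proof -
    obtain x y where s: "s = (x, y)" by (cases s)
    with that have "x \<in> fst ` S" "y \<in> snd ` S" by force+
    moreover have "indicator {s0} (x, y) = \<phi> x + h x * (y - x) - \<psi> y"
      using rep that s by blast
    ultimately show ?thesis by (simp add: s g_def \<phi>'_def h'_def \<psi>'_def)
  qed
  \<comment> \<open>The three summands absorb \<open>\<phi> z\<close>, the slope term
    \<open>h z * (y - z)\<close> and the indicator, each up to the factor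
    \<open>1 + \<bar>y\<bar>\<close>. Summing over \<open>Z\<close> gives one constant for all
    fibres of the cover.\<close>
  define C where "C z = \<bar>\<phi> z\<bar> + \<bar>h z\<bar> * (1 + \<bar>z\<bar>) + 1" for z
  have C0: "C z \<ge> 0" for z by (simp add: C_def)
  have bound: "\<bar>\<psi>' y\<bar> \<le> (\<Sum>z\<in>Z. C z) * (1 + \<bar>y\<bar>)" for y
  proof (cases "y \<in> snd ` S")
    case True
    then obtain z where z: "z \<in> Z" "(z, y) \<in> S" using Z(2) by (auto simp: fibre_def)
    have "\<psi> y = \<phi> z + h z * (y - z) - indicator {s0} (z, y)" using rep z(2) by fastforce
    moreover have "0 \<le> (indicator {s0} (z, y) :: real)" "indicator {s0} (z, y) \<le> (1 :: real)"
      by (simp_all add: indicator_def)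
    ultimately have "\<bar>\<psi> y\<bar> \<le> \<bar>\<phi> z\<bar> + \<bar>h z * (y - z)\<bar> + 1" by linarith
    then have "\<bar>\<psi> y\<bar> \<le> \<bar>\<phi> z\<bar> + \<bar>h z\<bar> * \<bar>y - z\<bar> + 1" by (simp only: abs_mult)
    also have "\<dots> \<le> \<bar>\<phi> z\<bar> * (1 + \<bar>y\<bar>) + \<bar>h z\<bar> * ((1 + \<bar>z\<bar>) * (1 + \<bar>y\<bar>)) + (1 + \<bar>y\<bar>)"
    proof -
      have "\<bar>y - z\<bar> \<le> \<bar>y\<bar> + \<bar>z\<bar>" by linarith
      also have "\<dots> \<le> (1 + \<bar>z\<bar>) * (1 + \<bar>y\<bar>)" by (simp add: algebra_simps)
      finally show ?thesis by (intro add_mono mult_left_mono) (simp_all add: distrib_left)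
    qed
    also have "\<dots> = C z * (1 + \<bar>y\<bar>)"
      by (simp only: C_def ring_distribs mult.assoc mult_1_left mult_1_right)
    also have "\<dots> \<le> (\<Sum>z\<in>Z. C z) * (1 + \<bar>y\<bar>)"
      using z(1) Z(1) C0 by (intro mult_right_mono member_le_sum) auto
    finally show ?thesis using True by (simp add: \<psi>'_def)
  next
    case False
    then show ?thesis using C0 by (simp add: \<psi>'_def sum_nonneg)
  qed
  have int\<psi>: "integrable \<nu> \<psi>'"
  proof (rule Bochner_Integration.integrable_bound)
    show "integrable \<nu> (\<lambda>y. (\<Sum>z\<in>Z. C z) * (1 + \<bar>y\<bar>))"
      using mom by (intro integrable_mult_right Bochner_Integration.integrable_add integrable_abs
          finite_measure.integrable_const[OF \<open>finite_measure \<nu>\<close>])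
    show "\<psi>' \<in> borel_measurable \<nu>" using \<psi>' measurable_cong_sets[OF \<nu> refl] by blast
    show "AE y in \<nu>. norm (\<psi>' y) \<le> norm ((\<Sum>z\<in>Z. C z) * (1 + \<bar>y\<bar>))"
      using bound by (auto intro: order_trans[OF _ abs_ge_self])
  qed
  have int_g: "has_bochner_integral L g (measure L {s0} + (\<integral>y. \<psi>' y \<partial>\<nu>))"
    if "prob_space L" and sL[measurable_cong]: "sets L = sets borel" and d: "distr L borel snd = \<nu>"
      and LS: "AE s in L. s \<in> S" for L
  proof -
    note [measurable] = borel_measurable_projections
    have gm: "g \<in> borel_measurable L" unfolding g_def by measurable
    have "has_bochner_integral L (\<lambda>s. \<psi>' (snd s)) (\<integral>y. \<psi>' y \<partial>\<nu>)"
      using int\<psi> unfolding d[symmetric] has_bochner_integral_iff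
      by (simp add: integrable_distr_eq integral_distr)
    moreover have "has_bochner_integral L (indicator {s0} :: _ \<Rightarrow> real) (measure L {s0})"
      using sL by (intro has_bochner_integral_real_indicator) (simp_all add: finite_measure.emeasure_finite less_top[symmetric] prob_space.axioms(1)[OF \<open>prob_space L\<close>])
    ultimately have "has_bochner_integral L (\<lambda>s. indicator {s0} s + \<psi>' (snd s))
        (measure L {s0} + (\<integral>y. \<psi>' y \<partial>\<nu>))"
      by (rule has_bochner_integral_add[rotated])
    moreover have "AE s in L. g s = indicator {s0} s + \<psi>' (snd s)"
      using LS by (rule eventually_mono) (rule rep')
    ultimately show ?thesis
      using has_bochner_integral_cong_AE[OF gm] borel_measurable_has_bochner_integral by blast
  qed
  show ?thesis
    using agree[of \<phi>' h'] int_g[OF Q] int_g[OF R]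
    by (simp add: g_def[abs_def] has_bochner_integral_iff)
qed

text \<open>The complement of \<open>A\<close> has mass zero in the mixture, which is a sum of
  nonnegative terms, and the weight of \<open>Q1\<close> is positive.\<close>

lemma AE_convex_combination:
  assumes "prob_space Q1" "sets Q1 = sets borel" "finite_measure Q" "sets Q = sets borel"
    and "0 < \<alpha>" "\<alpha> \<le> 1" and "A \<in> sets borel" and "AE s in Q. s \<in> A"
    and mix: "\<forall>B\<in>sets borel. measure Q B = \<alpha> * measure Q1 B + (1 - \<alpha>) * measure Q2 B"
  shows "AE s in Q1. s \<in> A"
proof -
  have A: "- A \<in> sets borel" using \<open>A \<in> sets borel\<close> by auto
  have "- A \<in> null_sets Q"
    using assms(4,8) A by (subst (asm) AE_iff_null_sets[of "- A", symmetric, simplified]) auto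
  then have "measure Q (- A) = 0" by (simp add: measure_def null_sets_def)
  with mix A have "\<alpha> * measure Q1 (- A) + (1 - \<alpha>) * measure Q2 (- A) = 0" by simp
  moreover have "(1 - \<alpha>) * measure Q2 (- A) \<ge> 0" "\<alpha> * measure Q1 (- A) \<ge> 0"
    using assms(5,6) by simp_all
  ultimately have "measure Q1 (- A) = 0" using assms(5) by (simp add: add_nonneg_eq_0_iff)
  then have "- A \<in> null_sets Q1"
    using A assms(2) by (simp add: null_sets_def
        finite_measure.emeasure_eq_measure[OF prob_space.axioms(1)[OF assms(1)]])
  from AE_not_in[OF this] show ?thesis by simp
qed

section \<open>The 2-link property and the WEP\<close>

text \<open>Among three points that a fibre shares with earlier fibres, the middle one would be
  strictly between two points of that fibre. The hypothesis compares indices rather than values of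
  \<open>x\<close>, so that it fits decreasing and increasing numberings alike.\<close>

lemma two_link_if_no_between:
  assumes "is_numbering (fst ` S) N x"
    and "\<And>i n y1 y' y2. \<lbrakk>i \<in> index_set N; n \<in> index_set N; i < n; (x n, y1) \<in> S; (x n, y2) \<in> S;
      (x i, y') \<in> S; y1 < y'; y' < y2\<rbrakk> \<Longrightarrow> False"
  shows "two_link_property S"
  unfolding two_link_property_def
proof (rule exI, rule exI, rule conjI[OF assms(1)], rule ballI)
  \<comment> \<open>Finiteness is proved along with the bound because \<open>card\<close> of an
    infinite set is 0.\<close>
  have card_le_2: "finite B \<and> card B \<le> 2"
    if between: "\<And>a b c. a \<in> B \<Longrightarrow> b \<in> B \<Longrightarrow> c \<in> B \<Longrightarrow> a < b \<Longrightarrow> b < c \<Longrightarrow> False"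
    for B :: "real set"
  proof (rule ccontr)
    assume "\<not> (finite B \<and> card B \<le> 2)"
    then have "\<exists>T\<subseteq>B. card T = 3"
      using infinite_arbitrarily_large[of B 3] obtain_subset_with_card_n[of 3 B]
      by (cases "finite B") (metis not_less_eq_eq numeral_2_eq_2 numeral_3_eq_3, blast)
    then obtain T where T: "T \<subseteq> B" "card T = 3" by blast
    obtain a b c where "T = {a, b, c}" and ne: "a \<noteq> b" "b \<noteq> c" "a \<noteq> c"
      using T(2) by (auto simp: card_3_iff)
    with T(1) have "a \<in> B" "b \<in> B" "c \<in> B" by auto
    then show False using between ne by (metis linorder_less_linear)
  qed
  fix n assume n: "n \<in> index_set N"
  have i: "i \<in> index_set N" if "Suc 0 \<le> i" "i < n" for i
    using that n by (auto simp: index_set_def intro: order_trans[of _ "enat n"])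
  show "finite (fibre S (x n) \<inter> (\<Union>i\<in>{1..<n}. fibre S (x i))) \<and>
      card (fibre S (x n) \<inter> (\<Union>i\<in>{1..<n}. fibre S (x i))) \<le> 2"
    by (intro card_le_2) (auto simp: fibre_def dest: assms(2)[OF i n])
qed

text \<open>The value of \<open>\<psi>\<close> at \<open>y\<close> is fixed by the first fibre that
  contains \<open>y\<close>, where the equation then holds by definition. The coefficients at index
  \<open>n\<close> have to meet a condition only at points seen before, and the 2-link property
  leaves at most two of these.\<close>

lemma two_link_imp_WEP:
  assumes "two_link_property S"
  shows "WEP S"
  unfolding WEP_def
proof
  have affine_interpolation: "\<exists>a b. \<forall>y\<in>B. a + b * (y - x0) = u y"
    if B: "finite B" "card B \<le> 2" for B x0 and u :: "real \<Rightarrow> real"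
  proof -
    consider "card B = 0" | "card B = 1" | "card B = 2"
      using B(2) by linarith
    then show ?thesis
    proof cases
      case 1
      then show ?thesis using B(1) by auto
    next
      case 2
      then obtain p where "B = {p}" by (auto simp: card_1_singleton_iff)
      then have "\<forall>y\<in>B. u p + 0 * (y - x0) = u y" by simp
      then show ?thesis by blast
    next
      case 3
      then obtain p q where pq: "B = {p, q}" "p \<noteq> q" by (auto simp: card_2_iff)
      define b where "b = (u q - u p) / (q - p)"
      have b: "b * (q - p) = u q - u p" using pq(2) by (simp add: b_def)
      have "(u p - b * (p - x0)) + b * (q - x0) = u p + b * (q - p)"
        by (simp add: algebra_simps)
      with b have "\<forall>y\<in>B. (u p - b * (p - x0)) + b * (y - x0) = u y"
        by (simp add: pq(1))
      then show ?thesis by blast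
    qed
  qed
  fix f :: "real \<times> real \<Rightarrow> real"
  obtain N x where num: "is_numbering (fst ` S) N x"
    and link: "\<And>n. n \<in> index_set N \<Longrightarrow>
        finite (fibre S (x n) \<inter> (\<Union>i\<in>{1..<n}. fibre S (x i))) \<and>
        card (fibre S (x n) \<inter> (\<Union>i\<in>{1..<n}. fibre S (x i))) \<le> 2"
    using assms unfolding two_link_property_def by blast
  define first where "first y = (LEAST i. i \<in> index_set N \<and> (x i, y) \<in> S)" for y
  have first: "first y \<in> index_set N \<and> (x (first y), y) \<in> S" "first y \<le> n"
    if "n \<in> index_set N" "(x n, y) \<in> S" for n y
    using that unfolding first_def
    by (metis (mono_tags, lifting) LeastI, simp add: Least_le)
  text \<open>The value of \<open>\<psi> y\<close> that the coefficients chosen at index \<open>first y\<close> force.\<close>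
  define \<Psi> where "\<Psi> c y = fst (c (first y)) + snd (c (first y)) * (y - x (first y))
      - f (x (first y), y)" for c :: "nat \<Rightarrow> real \<times> real" and y
  \<comment> \<open>\<open>P c n r\<close> says that the pair \<open>r\<close> is compatible at
    index \<open>n\<close> with the earlier choices. The guard \<open>first y < n\<close> makes it
    depend on \<open>c\<close> below \<open>n\<close> alone, as well-founded choice demands.\<close>
  define P where "P c n r \<longleftrightarrow> (n \<in> index_set N \<longrightarrow> (\<forall>y. (x n, y) \<in> S \<longrightarrow> first y < n \<longrightarrow>
      fst r + snd r * (y - x n) = f (x n, y) + \<Psi> c y))" for c n and r :: "real \<times> real"
  have "\<exists>c. \<forall>n. P c n (c n)"
  proof (rule dependent_wellorder_choice)
    show "P c n r = P c' n r" if "\<And>m. m < n \<Longrightarrow> c m = c' m" for r c c' n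
      using that unfolding P_def \<Psi>_def by auto
  next
    fix n c
    show "\<exists>r. P c n r"
    proof (cases "n \<in> index_set N")
      case True
      obtain a b where ab: "\<forall>y\<in>fibre S (x n) \<inter> (\<Union>i\<in>{1..<n}. fibre S (x i)).
          a + b * (y - x n) = f (x n, y) + \<Psi> c y"
        using affine_interpolation[of _ "x n" "\<lambda>y. f (x n, y) + \<Psi> c y"] link[OF True] by blast
      have "P c n (a, b)"
        unfolding P_def
      proof (intro impI allI)
        fix y assume y: "(x n, y) \<in> S" "first y < n"
        with first(1)[OF True y(1)] have "first y \<in> {1..<n}" "y \<in> fibre S (x (first y))"
          by (auto simp: index_set_def fibre_def)
        then have "y \<in> fibre S (x n) \<inter> (\<Union>i\<in>{1..<n}. fibre S (x i))"
          using y(1) by (auto simp: fibre_def)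
        with ab show "fst (a, b) + snd (a, b) * (y - x n) = f (x n, y) + \<Psi> c y"
          by simp
      qed
      then show ?thesis ..
    qed (simp add: P_def)
  qed
  then obtain c where c: "\<And>n. P c n (c n)" by blast
  define idx where "idx = inv_into (index_set N) x"
  have "\<forall>(s, y)\<in>S. f (s, y) = fst (c (idx s)) + snd (c (idx s)) * (y - s) - \<Psi> c y"
  proof clarify
    fix s y assume sy: "(s, y) \<in> S"
    have bij: "bij_betw x (index_set N) (fst ` S)" using num by (simp add: is_numbering_def)
    have s: "s \<in> x ` index_set N"
      using imageI[OF sy, of fst] bij_betw_imp_surj_on[OF bij] by simp
    then have idx: "idx s \<in> index_set N" "x (idx s) = s"
      unfolding idx_def by (auto intro: inv_into_into f_inv_into_f)
    show "f (s, y) = fst (c (idx s)) + snd (c (idx s)) * (y - s) - \<Psi> c y"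
    \<comment> \<open>At a point seen before, the equation is the constraint \<open>P\<close>; at a
      new point it is the definition of \<open>\<Psi>\<close>.\<close>
    proof (cases "first y < idx s")
      case True
      then show ?thesis using c[of "idx s"] idx sy by (auto simp: P_def)
    next
      case False
      then have "first y = idx s" using first(2)[of "idx s" y] idx sy by auto
      then show ?thesis using idx by (simp add: \<Psi>_def)
    qed
  qed
  then show "\<exists>\<phi> h \<psi>. \<forall>(x, y)\<in>S. f (x, y) = \<phi> x + h x * (y - x) - \<psi> y"
    by (intro exI[of _ "\<lambda>s. fst (c (idx s))"] exI[of _ "\<lambda>s. snd (c (idx s))"] exI[of _ "\<Psi> c"])
qed

section \<open>Curtains whose first projection has a monotone numbering\<close>

theorem proposition5p8:
  fixes \<mu> \<nu> :: "real measure" and X Y :: "real set"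
    and \<pi> :: "(real \<times> real) measure" and S :: "(real \<times> real) set"
  assumes "prob_space \<mu>" and "sets \<mu> = sets borel"
    and "prob_space \<nu>" and "sets \<nu> = sets borel"
    and "countable X" and "X \<subseteq> {0..}" and "emeasure \<mu> X = 1"
    and "countable Y" and "Y \<subseteq> {0..}" and "emeasure \<nu> Y = 1"
    and "has_bochner_integral \<mu> (\<lambda>x. x) 1"
    and "has_bochner_integral \<nu> (\<lambda>y. y) 1"
    and "convex_order \<mu> \<nu>"
    and "S = atoms_on X Y \<pi>"
    and "(is_left_curtain \<mu> \<nu> \<pi> \<and>
            (\<exists>N x. is_numbering (fst ` S) N x \<and> strict_antimono_on (index_set N) x)) \<or>
         (is_right_curtain \<mu> \<nu> \<pi> \<and>
            (\<exists>N x. is_numbering (fst ` S) N x \<and> strict_mono_on (index_set N) x))"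
  shows "two_link_property S \<and> WEP S \<and>
    ((\<exists>Z. finite Z \<and> Z \<subseteq> fst ` S \<and> snd ` S = (\<Union>z\<in>Z. fibre S z))
       \<longrightarrow> extremal_coupling \<mu> \<nu> \<pi>)"
proof -
  have \<pi>: "\<pi> \<in> martingale_couplings \<mu> \<nu>"
    using assms(15) by (auto simp: is_left_curtain_def is_right_curtain_def)
  then have "prob_space \<pi>" and s\<pi>: "sets \<pi> = sets borel"
    by (auto simp: martingale_couplings_def)
  \<comment> \<open>Atoms lie in every Borel set of full measure, so the forbidden pattern is
    excluded on \<open>S\<close> as well as on \<open>\<Gamma>\<close>.\<close>
  have full: "s \<in> \<Gamma>" if "s \<in> S" "\<Gamma> \<in> sets borel" "emeasure \<pi> \<Gamma> = 1" for s \<Gamma>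
    using that assms(14) s\<pi> atom_in_full_set[OF \<open>prob_space \<pi>\<close>, of \<Gamma> s]
    by (auto simp: atoms_on_def)
  have link: "two_link_property S"
    using assms(15)
  proof
    assume *: "is_left_curtain \<mu> \<nu> \<pi> \<and>
      (\<exists>N x. is_numbering (fst ` S) N x \<and> strict_antimono_on (index_set N) x)"
    then obtain N x where "is_numbering (fst ` S) N x" and x: "strict_antimono_on (index_set N) x"
      by blast
    moreover obtain \<Gamma> where "\<Gamma> \<in> sets borel" "emeasure \<pi> \<Gamma> = 1"
      and "\<And>x y1 y2 x' y'. (x, y1) \<in> \<Gamma> \<Longrightarrow> (x, y2) \<in> \<Gamma> \<Longrightarrow> (x', y') \<in> \<Gamma>
        \<Longrightarrow> \<not> (x < x' \<and> y1 < y' \<and> y' < y2)"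
      using * unfolding is_left_curtain_def left_monotone_def by blast
    \<comment> \<open>For \<open>i < n\<close> the decreasing numbering gives
      \<open>x n < x i\<close>, so \<open>x n\<close> carries the two outer points of the forbidden
      pattern and \<open>x i\<close> the middle one.\<close>
    ultimately show ?thesis
      using full monotone_onD[OF x] by (intro two_link_if_no_between) blast+
  next
    assume *: "is_right_curtain \<mu> \<nu> \<pi> \<and>
      (\<exists>N x. is_numbering (fst ` S) N x \<and> strict_mono_on (index_set N) x)"
    then obtain N x where "is_numbering (fst ` S) N x" and x: "strict_mono_on (index_set N) x"
      by blast
    moreover obtain \<Gamma> where "\<Gamma> \<in> sets borel" "emeasure \<pi> \<Gamma> = 1"
      and "\<And>x y1 y2 x' y'. (x, y1) \<in> \<Gamma> \<Longrightarrow> (x, y2) \<in> \<Gamma> \<Longrightarrow> (x', y') \<in> \<Gamma>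
        \<Longrightarrow> \<not> (x > x' \<and> y1 < y' \<and> y' < y2)"
      using * unfolding is_right_curtain_def right_monotone_def by blast
    ultimately show ?thesis
      using full monotone_onD[OF x] by (intro two_link_if_no_between) blast+
  qed
  have full_AE: "AE x in M. x \<in> A"
    if "prob_space M" "sets M = sets borel" "countable A" "emeasure M A = 1" for M and A :: "real set"
    using prob_space.AE_in_set_eq_1[OF that(1), of A] sets.countable[of A M] that(2-4)
    by (simp add: measure_def)
  have "AE s in \<pi>. s \<in> S"
    unfolding assms(14) using assms(1-5,7,8,10) by (intro AE_in_atoms_on[OF \<pi>] full_AE)
  moreover have "countable S"
    using assms(5,8,14) by (intro countable_subset[of S "X \<times> Y"]) (auto simp: atoms_on_def)
  ultimately have S: "AE s in \<pi>. s \<in> S" "countable S" by blast+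
  have WEP: "WEP S" using two_link_imp_WEP[OF link] .
  have "extremal_coupling \<mu> \<nu> \<pi>" if Z: "finite Z" "snd ` S = (\<Union>z\<in>Z. fibre S z)" for Z
  proof -
    have fin: "finite_measure \<mu>" "finite_measure \<nu>"
      using assms(1,3) by (auto simp: prob_space_def)
    have mc: "prob_space L" "sets L = sets borel" "distr L borel snd = \<nu>"
      if "L \<in> martingale_couplings \<mu> \<nu>" for L
      using that by (auto simp: martingale_couplings_def)
    \<comment> \<open>A coupling concentrated on \<open>S\<close> is determined by its point masses
      there, and the WEP forces these to be those of \<open>\<pi>\<close>.\<close>
    have unique: "\<pi> = L" if L: "L \<in> martingale_couplings \<mu> \<nu>" and LS: "AE s in L. s \<in> S" for L
    proof (rule measure_eq_countable_AE[OF _ S(2,1) LS])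
      show "sets \<pi> = sets L" and "{s} \<in> sets \<pi>" for s using s\<pi> mc(2)[OF L] by auto
      have "measure \<pi> {s} = measure L {s}" for s
      proof (rule WEP_imp_eq_atoms[OF WEP S(2) Z fin(2) assms(4) _ mc[OF \<pi>] S(1) mc[OF L] LS])
        show "integrable \<nu> (\<lambda>y. y)" using assms(12) by (simp add: has_bochner_integral_iff)
        have "AE s in M. fst s \<in> fst ` S" if "AE s in M. s \<in> S" for M
          using that by (rule eventually_mono) simp
        note lim = integral_affine_by_fibres[OF mc(2) martingale_coupling_fibre_integral[OF _ fin(1) assms(2)]
            countable_image[OF S(2)] this]
        fix \<phi> h :: "real \<Rightarrow> real"
        assume int: "integrable \<pi> (\<lambda>s. \<phi> (fst s) + h (fst s) * (snd s - fst s))"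
          "integrable L (\<lambda>s. \<phi> (fst s) + h (fst s) * (snd s - fst s))"
        \<comment> \<open>Both integrals are limits of the same partial sums, built from
          \<open>\<mu>\<close>, \<open>\<phi>\<close> and the enumeration of the first projection of
          \<open>S\<close>.\<close>
        show "(\<integral>s. \<phi> (fst s) + h (fst s) * (snd s - fst s) \<partial>\<pi>)
            = (\<integral>s. \<phi> (fst s) + h (fst s) * (snd s - fst s) \<partial>L)"
          by (rule LIMSEQ_unique[OF lim[OF \<pi> \<pi> S(1) int(1)] lim[OF L L LS int(2)]])
      qed
      then show "emeasure \<pi> {s} = emeasure L {s}" for s
        using mc(1)[OF \<pi>] mc(1)[OF L] by (simp add: finite_measure.emeasure_eq_measure prob_space_def)
    qed
    have bS: "S \<in> sets borel"
      using sets.countable[of S borel] S(2) by auto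
    have "\<pi> = Q1 \<and> \<pi> = Q2"
      if \<alpha>: "0 < \<alpha>" "\<alpha> < 1" and Q1: "Q1 \<in> martingale_couplings \<mu> \<nu>"
        and Q2: "Q2 \<in> martingale_couplings \<mu> \<nu>"
        and mix: "\<forall>A\<in>sets borel. measure \<pi> A = \<alpha> * measure Q1 A + (1 - \<alpha>) * measure Q2 A"
      for \<alpha> Q1 Q2
    proof
      have fin\<pi>: "finite_measure \<pi>" using \<open>prob_space \<pi>\<close> by (simp add: prob_space_def)
      have "AE s in Q1. s \<in> S"
        using \<alpha> by (intro AE_convex_combination[OF mc(1,2)[OF Q1] fin\<pi> s\<pi> _ _ bS S(1) mix]) simp_all
      then show "\<pi> = Q1" by (rule unique[OF Q1])
      \<comment> \<open>The same argument handles \<open>Q2\<close> once the two components are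
        exchanged, with weight \<open>1 - \<alpha>\<close> in place of
        \<open>\<alpha>\<close>.\<close>
      have mix': "\<forall>A\<in>sets borel. measure \<pi> A = (1 - \<alpha>) * measure Q2 A + (1 - (1 - \<alpha>)) * measure Q1 A"
        using mix by simp
      have "AE s in Q2. s \<in> S"
        using \<alpha> by (intro AE_convex_combination[OF mc(1,2)[OF Q2] fin\<pi> s\<pi> _ _ bS S(1) mix']) simp_all
      then show "\<pi> = Q2" by (rule unique[OF Q2])
    qed
    then show ?thesis using \<pi> unfolding extremal_coupling_def by blast
  qed
  with link WEP show ?thesis by blast
qed

end
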